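(* For every positive integer $d$ and all functions $f,g\colon\mathbb{Z}^d\to[0,\infty)$ supported in $\{0,1\}^d$ and satisfying $\|f\|_{\ell^1(\{0,1\}^d)}=\|g\|_{\ell^1(\{0,1\}^d)}=1$ one has \[ \mathrm{H}_{\mathbb{Z}^d}(f\ast g) \geq \frac{3}{4} \big( \mathrm{H}_{\mathbb{Z}^d}(f) +\mathrm{H}_{\mathbb{Z}^d}(g) \big). \] Equality is attained when $f=g=2^{-d}\mathbf{1}_{\{0,1\}^d}$, which makes the constant $3/4$ sharp.
   Context: The convolution is $(f\ast g)(x) := \sum_{y\in\mathbb{Z}^d} f(x-y) g(y)$ for $x\in\mathbb{Z}^d$. For a finitely supported $h\colon\mathbb{Z}^d\to[0,\infty)$ with $\sum_x h(x)=1$, its Shannon entropy is $\mathrm{H}_{\mathbb{Z}^d}(h) := - \sum_{x\in\mathbb{Z}^d} h(x) \log_2 h(x)$, with the convention $0\log_2 0=0$. $\mathbf{1}_{\{0,1\}^d}$ is the indicator function of $\{0,1\}^d$. *)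

theory Defs
  imports "HOL-Analysis.Analysis"
begin

text \<open>
  The lattice of integer points in dimension \<open>d\<close> is the type \<open>int ^ 'd\<close> with \<open>d = CARD('d)\<close>.
  In all uses below the summands of the infinite sums have finite support.
\<close>

definition convolution :: "('a::ab_group_add \<Rightarrow> real) \<Rightarrow> ('a \<Rightarrow> real) \<Rightarrow> 'a \<Rightarrow> real"
  where "convolution f g = (\<lambda>x. \<Sum>\<^sub>\<infinity>y. f (x - y) * g y)"

text \<open>The convention \<open>0 * log 2 0 = 0\<close> is automatic, since \<open>log\<close> is total.\<close>

definition shannon_entropy :: "('a \<Rightarrow> real) \<Rightarrow> real"
  where "shannon_entropy h = - (\<Sum>\<^sub>\<infinity>x. h x * log 2 (h x))"

definition binary_cube :: "(int ^ 'd) set"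
  where "binary_cube = {x. \<forall>i. x $ i \<in> {0, 1}}"

definition l1_norm_on :: "'a set \<Rightarrow> ('a \<Rightarrow> real) \<Rightarrow> real"
  where "l1_norm_on A f = (\<Sum>\<^sub>\<infinity>x\<in>A. \<bar>f x\<bar>)"

definition cube_density :: "(int ^ 'd \<Rightarrow> real) \<Rightarrow> bool"
  where "cube_density f \<longleftrightarrow>
    (\<forall>x. 0 \<le> f x) \<and> (\<forall>x. x \<notin> binary_cube \<longrightarrow> f x = 0) \<and> l1_norm_on binary_cube f = 1"

definition uniform_cube :: "int ^ 'd \<Rightarrow> real"
  where "uniform_cube = (\<lambda>x. 1 / 2 ^ CARD('d) * indicator binary_cube x)"

end

theory Submission
  imports Defs
begin

text \<open>
  Proceed by induction on the dimension, conditioning on one coordinate. With \<open>f\<^sub>a\<close>, \<open>g\<^sub>b\<close> the slices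
  of \<open>f\<close>, \<open>g\<close>, the slices of \<open>f * g\<close> are \<open>f\<^sub>0 * g\<^sub>0\<close>, \<open>f\<^sub>0 * g\<^sub>1 + f\<^sub>1 * g\<^sub>0\<close> and \<open>f\<^sub>1 * g\<^sub>1\<close>; the chain rule and
  superadditivity of the homogeneous entropy reduce the claim to dimension one. There, with
  \<open>\<psi> a b = (a + b) ln (a + b) - a ln a - b ln b\<close>, it reads
  \<open>\<psi> (a d) (b c) \<le> ((c + d) \<psi> a b + (a + b) \<psi> c d) / 4\<close>, and follows by AM-GM from
  \<open>4 ln 2 * (a b) / (a + b) \<le> \<psi> a b \<le> 2 ln 2 * sqrt (a b)\<close>.
\<close>

subsection \<open>Binary entropy\<close>

definition xlnx :: "real \<Rightarrow> real"
  where "xlnx x = x * ln x"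

lemma xlnx_0 [simp]: "xlnx 0 = 0"
  by (simp add: xlnx_def)

lemma xlnx_1 [simp]: "xlnx 1 = 0"
  by (simp add: xlnx_def)

lemma xlnx_mult: "x \<ge> 0 \<Longrightarrow> y \<ge> 0 \<Longrightarrow> xlnx (x * y) = y * xlnx x + x * xlnx y"
  by (cases "x = 0"; cases "y = 0") (simp_all add: xlnx_def ln_mult_pos distrib_left mult_ac)

text \<open>This is the \<psi> of the overview: \<open>a + b\<close> times the binary entropy, in
  nats, of the proportions of \<open>a\<close> and \<open>b\<close>. Homogeneity of degree one makes
  normalisation unnecessary.\<close>

definition split_entropy :: "real \<Rightarrow> real \<Rightarrow> real"
  where "split_entropy a b = xlnx (a + b) - xlnx a - xlnx b"

lemma split_entropy_commute: "split_entropy a b = split_entropy b a"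
  by (simp add: split_entropy_def add.commute)

lemma split_entropy_0 [simp]: "split_entropy a 0 = 0" "split_entropy 0 b = 0"
  by (simp_all add: split_entropy_def)

lemma split_entropy_scale:
  assumes "c \<ge> 0" "a \<ge> 0" "b \<ge> 0"
  shows "split_entropy (c * a) (c * b) = c * split_entropy a b"
proof -
  have "xlnx (c * a + c * b) = (a + b) * xlnx c + c * xlnx (a + b)"
    using assms by (simp add: distrib_left[symmetric] xlnx_mult)
  then show ?thesis
    using assms by (simp add: split_entropy_def xlnx_mult algebra_simps)
qed

lemma split_entropy_probability:
  "split_entropy t (1 - t) = - (t * ln t + (1 - t) * ln (1 - t))"
  by (simp add: split_entropy_def xlnx_def)

section \<open>Sharp lower and upper bounds for the binary entropy\<close>

text \<open>All coefficients of this series are positive, so convexity and monotonicity of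
  \<open>- ln (1 - u) / u\<close> can be checked term by term.\<close>

lemma neg_ln_one_minus_over_sums:
  fixes u :: real
  assumes "0 < u" "u < 1"
  shows "(\<lambda>n. u ^ n / real (Suc n)) sums (- ln (1 - u) / u)"
proof -
  have "(\<lambda>n. - ((u ^ n) / real n)) sums ln (1 - u)"
    using ln_series'[of "- u"] assms by simp
  then have "(\<lambda>n. u ^ n / real n) sums (- ln (1 - u))"
    using sums_minus by fastforce
  \<comment> \<open>The term at \<open>n = 0\<close> is a division by zero, hence 0, so shifting the
    index does not change the sum.\<close>
  then have "(\<lambda>n. u ^ Suc n / real (Suc n)) sums (- ln (1 - u))"
    by (subst sums_Suc_iff) simp
  from sums_divide[OF this, of u] show ?thesis
    using assms by (simp del: of_nat_Suc)
qed

text \<open>Midpoint convexity of powers. The induction step multiplies by the mean and uses that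
  \<open>u - v\<close> and \<open>u ^ n - v ^ n\<close> have the same sign.\<close>

lemma two_power_mean_le:
  fixes u v :: real
  assumes "u \<ge> 0" "v \<ge> 0"
  shows "2 * ((u + v) / 2) ^ n \<le> u ^ n + v ^ n"
proof (induction n)
  case (Suc n)
  have "0 \<le> (u - v) * (u ^ n - v ^ n)"
    using assms power_mono[of u v n] power_mono[of v u n]
    by (cases "u \<le> v") (auto intro: mult_nonpos_nonpos mult_nonneg_nonneg)
  moreover have "(u + v) / 2 * (2 * ((u + v) / 2) ^ n) \<le> (u + v) / 2 * (u ^ n + v ^ n)"
    using assms by (intro mult_left_mono Suc) auto
  ultimately show ?case
    by (simp add: algebra_simps)
qed simp

text \<open>After division by \<open>t * (1 - t)\<close> the left-hand side becomes \<open>k t + k (1 - t)\<close>, where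
  \<open>k t = - ln (1 - t) / t\<close> is convex, so that its minimum is at \<open>t = 1 / 2\<close>.\<close>

lemma split_entropy_ge:
  assumes "0 < t" "t < 1"
  shows "split_entropy t (1 - t) \<ge> 4 * ln 2 * (t * (1 - t))"
proof -
  have "2 * (- ln (1 - 1 / 2) / (1 / 2)) \<le> - ln (1 - t) / t + - ln (1 - (1 - t)) / (1 - t)"
  proof (rule sums_le)
    show "(\<lambda>n. 2 * ((1 / 2) ^ n / real (Suc n))) sums (2 * (- ln (1 - 1 / 2) / (1 / 2)))"
      by (intro sums_mult neg_ln_one_minus_over_sums) auto
    show "(\<lambda>n. t ^ n / real (Suc n) + (1 - t) ^ n / real (Suc n)) sums
        (- ln (1 - t) / t + - ln (1 - (1 - t)) / (1 - t))"
      using assms by (intro sums_add neg_ln_one_minus_over_sums) auto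
    show "2 * ((1 / 2) ^ n / real (Suc n)) \<le> t ^ n / real (Suc n) + (1 - t) ^ n / real (Suc n)" for n
      using two_power_mean_le[of t "1 - t" n] assms
      by (simp add: add_divide_distrib[symmetric] divide_right_mono del: of_nat_Suc)
  qed
  then have "4 * ln 2 \<le> - ln (1 - t) / t + - ln t / (1 - t)"
    by (simp add: ln_div)
  then have "4 * ln 2 * (t * (1 - t)) \<le> (- ln (1 - t) / t + - ln t / (1 - t)) * (t * (1 - t))"
    using assms by (intro mult_right_mono) auto
  also have "\<dots> = split_entropy t (1 - t)"
    using assms by (simp add: split_entropy_probability field_simps)
  finally show ?thesis .
qed

text \<open>Since \<open>t \<le> 1 - t\<close>, the series of \<open>- ln (1 - u) / u\<close> at
  \<open>t\<close> is termwise below the one at \<open>1 - t\<close>; multiplying by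
  \<open>t * (1 - t)\<close> gives the claim.\<close>

lemma xlnx_le_xlnx_one_minus:
  assumes "0 < t" "t \<le> 1 / 2"
  shows "xlnx t \<le> xlnx (1 - t)"
proof -
  have "t ^ n / real (Suc n) \<le> (1 - t) ^ n / real (Suc n)" for n
    using assms by (intro divide_right_mono power_mono) auto
  then have "- ln (1 - t) / t \<le> - ln (1 - (1 - t)) / (1 - t)"
    using sums_le[OF _ neg_ln_one_minus_over_sums[of t] neg_ln_one_minus_over_sums[of "1 - t"]] assms
    by auto
  then show ?thesis
    using assms by (simp add: xlnx_def field_simps)
qed

text \<open>The quotient of the two sides is nondecreasing on \<open>(0, 1/2]\<close>: up to a positive factor its
  derivative is \<open>xlnx (1 - t) - xlnx t\<close>.\<close>

lemma split_entropy_le_lower_half: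
  assumes "0 < t" "t \<le> 1 / 2"
  shows "split_entropy t (1 - t) \<le> 2 * ln 2 * sqrt (t * (1 - t))"
proof -
  define H where "H x = - (x * ln x + (1 - x) * ln (1 - x))" for x :: real
  define q where "q x = H x / sqrt (x * (1 - x))" for x
  have "q t \<le> q (1 / 2)"
  proof (rule DERIV_nonneg_imp_nondecreasing[OF assms(2)])
    fix x assume "t \<le> x" "x \<le> 1 / 2"
    then have x: "0 < x" "x \<le> 1 / 2" using assms by auto
    define w r where "w = x * (1 - x)" and "r = sqrt w"
    have w: "w > 0" using x by (simp add: w_def)
    then have r: "r > 0" "w = r * r" by (simp_all add: r_def)
    have dH: "(H has_real_derivative (ln (1 - x) - ln x)) (at x)"
      unfolding H_def using x by (auto intro!: derivative_eq_intros)
    have ds: "((\<lambda>x. sqrt (x * (1 - x))) has_real_derivative ((1 - 2 * x) / (2 * r))) (at x)"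
      unfolding r_def w_def using x by (auto intro!: derivative_eq_intros simp: field_simps)
    define D where "D = ((ln (1 - x) - ln x) * r - H x * ((1 - 2 * x) / (2 * r))) / (r * r)"
    have "sqrt (x * (1 - x)) \<noteq> 0" using x by simp
    from DERIV_divide[OF dH ds this] have dq: "(q has_real_derivative D) (at x)"
      unfolding q_def D_def w_def[symmetric] r_def[symmetric] .
    \<comment> \<open>Multiplying the numerator of the quotient rule by \<open>2 * r\<close>
      replaces the root by \<open>w = r * r\<close>, after which the logarithms collapse.\<close>
    have "(ln (1 - x) - ln x) * r - H x * ((1 - 2 * x) / (2 * r))
        = (2 * w * (ln (1 - x) - ln x) - H x * (1 - 2 * x)) / (2 * r)"
      using r by (simp add: divide_simps)
    also have "2 * w * (ln (1 - x) - ln x) - H x * (1 - 2 * x) = xlnx (1 - x) - xlnx x"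
      by (simp add: w_def H_def xlnx_def algebra_simps)
    finally have "D \<ge> 0"
      unfolding D_def using xlnx_le_xlnx_one_minus[OF x] r by simp
    with dq show "\<exists>y. (q has_real_derivative y) (at x) \<and> 0 \<le> y" by blast
  qed
  also have "q (1 / 2) = 2 * ln 2"
  proof -
    have "sqrt (1 / 2 * (1 - 1 / 2)) = (1 / 2 :: real)" by (simp add: real_sqrt_divide)
    then show ?thesis unfolding q_def H_def by (simp only:) (simp add: ln_div)
  qed
  finally show ?thesis
    using assms by (simp add: q_def H_def split_entropy_probability divide_le_eq)
qed

lemma split_entropy_le:
  assumes "0 < t" "t < 1"
  shows "split_entropy t (1 - t) \<le> 2 * ln 2 * sqrt (t * (1 - t))"
proof (cases "t \<le> 1 / 2")
  case False
  then show ?thesis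
    using split_entropy_le_lower_half[of "1 - t"] assms
    by (simp add: split_entropy_commute mult.commute)
qed (use split_entropy_le_lower_half assms in blast)

text \<open>Rescaling of \<open>split_entropy_ge\<close> by homogeneity, with \<open>a + b\<close>
  kept on the left to avoid a quotient.\<close>

lemma split_entropy_ge_mult:
  assumes "a > 0" "b > 0"
  shows "(a + b) * split_entropy a b \<ge> 4 * ln 2 * (a * b)"
proof -
  define t where "t = a / (a + b)"
  have t: "0 < t" "t < 1" "a = (a + b) * t" "b = (a + b) * (1 - t)"
    using assms by (auto simp: t_def field_simps)
  have "4 * ln 2 * (a * b) = (a + b)\<^sup>2 * (4 * ln 2 * (t * (1 - t)))"
    by (subst (1) t(3), subst (2) t(4)) (simp add: power2_eq_square)
  also have "\<dots> \<le> (a + b)\<^sup>2 * split_entropy t (1 - t)"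
    by (intro mult_left_mono split_entropy_ge t) auto
  also have "\<dots> = (a + b) * split_entropy ((a + b) * t) ((a + b) * (1 - t))"
    using assms t(1,2) by (simp add: split_entropy_scale power2_eq_square)
  finally show ?thesis
    using t(3,4) by simp
qed

lemma split_entropy_le_sqrt:
  assumes "a \<ge> 0" "b \<ge> 0"
  shows "split_entropy a b \<le> 2 * ln 2 * sqrt (a * b)"
proof (cases "a = 0 \<or> b = 0")
  case False
  define t where "t = a / (a + b)"
  have t: "0 < t" "t < 1" "a = (a + b) * t" "b = (a + b) * (1 - t)"
    using assms False by (auto simp: t_def field_simps)
  have "split_entropy a b = split_entropy ((a + b) * t) ((a + b) * (1 - t))"
    using t(3,4) by simp
  also have "\<dots> = (a + b) * split_entropy t (1 - t)"
    using assms t(1,2) by (simp add: split_entropy_scale)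
  also have "\<dots> \<le> (a + b) * (2 * ln 2 * sqrt (t * (1 - t)))"
    using assms by (intro mult_left_mono split_entropy_le t) auto
  also have "\<dots> = 2 * ln 2 * sqrt ((a + b)\<^sup>2 * (t * (1 - t)))"
    using assms by (simp add: real_sqrt_mult)
  also have "(a + b)\<^sup>2 * (t * (1 - t)) = ((a + b) * t) * ((a + b) * (1 - t))"
    by (simp add: power2_eq_square)
  finally show ?thesis
    using t(3,4) by simp
qed auto

lemma split_entropy_nonneg:
  assumes "a \<ge> 0" "b \<ge> 0"
  shows "split_entropy a b \<ge> 0"
proof (cases "a = 0 \<or> b = 0")
  case False
  then have "0 \<le> 4 * ln 2 * (a * b)" "a + b > 0" using assms by auto
  with False show ?thesis
    using split_entropy_ge_mult[of a b] assms
    by (smt (verit) mult_pos_neg)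
qed auto

text \<open>The source of the constant: a loss of at most one quarter here leaves 3/4 later.
  Equality at \<open>a = b\<close>, \<open>c = d\<close> shows that 1/4 is optimal.\<close>

lemma split_entropy_cross_le:
  assumes "a \<ge> 0" "b \<ge> 0" "c \<ge> 0" "d \<ge> 0"
  shows "split_entropy (a * d) (b * c)
    \<le> 1 / 4 * ((c + d) * split_entropy a b + (a + b) * split_entropy c d)"
proof (cases "a = 0 \<or> b = 0 \<or> c = 0 \<or> d = 0")
  case True
  then show ?thesis
    using assms split_entropy_nonneg by auto
next
  case False
  then have pos: "a > 0" "b > 0" "c > 0" "d > 0" using assms by auto
  define F G where "F = a + b" and "G = c + d"
  have FG: "F > 0" "G > 0" using pos by (auto simp: F_def G_def)
  \<comment> \<open>\<open>F\<close> and \<open>G\<close> cancel in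
    \<open>x * y = (a * d) * (b * c)\<close>, while \<open>4 * ln 2 * x\<close> and
    \<open>4 * ln 2 * y\<close> are the lower bounds for \<open>G * split_entropy a b\<close> and
    \<open>F * split_entropy c d\<close>.\<close>
  define x y where "x = G * (a * b) / F" and "y = F * (c * d) / G"
  have xy: "x \<ge> 0" "y \<ge> 0" using pos FG by (auto simp: x_def y_def)
  have ge: "4 * ln 2 * (G * (p * q) / F) \<le> G * split_entropy p q"
    if "p > 0" "q > 0" "G > 0" "F = p + q" for F G p q :: real
    using mult_left_mono[OF split_entropy_ge_mult[OF that(1,2)], of G] that
    by (simp add: field_simps)
  have "sqrt ((a * d) * (b * c)) = sqrt (x * y)"
    using FG by (simp add: x_def y_def field_simps)
  then have "split_entropy (a * d) (b * c) \<le> 2 * ln 2 * sqrt (x * y)"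
    using split_entropy_le_sqrt[of "a * d" "b * c"] pos by simp
  also have "\<dots> \<le> 2 * ln 2 * ((x + y) / 2)"
    using arith_geo_mean_sqrt[OF xy] by (intro mult_left_mono) auto
  also have "\<dots> = 1 / 4 * (4 * ln 2 * x + 4 * ln 2 * y)"
    by (simp add: algebra_simps)
  also have "\<dots> \<le> 1 / 4 * (G * split_entropy a b + F * split_entropy c d)"
    unfolding x_def y_def using pos FG
    by (intro mult_left_mono add_mono ge) (auto simp: F_def G_def)
  finally show ?thesis by (simp add: F_def G_def)
qed

section \<open>Gibbs' inequality and superadditivity\<close>

text \<open>Gibbs' inequality, from \<open>ln z \<le> z - 1\<close>. It bounds
  \<open>split_entropy\<close> by functions linear in \<open>a\<close> and \<open>b\<close>, which
  can be summed.\<close>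

lemma split_entropy_le_cross_entropy:
  assumes "a \<ge> 0" "b \<ge> 0" "p > 0" "q > 0" "p + q = 1"
  shows "split_entropy a b \<le> - (a * ln p) - b * ln q"
proof -
  \<comment> \<open>The bound for a single outcome; the corrections \<open>r * (a + b) - x\<close>
    cancel over both outcomes because \<open>p + q = 1\<close>.\<close>
  have *: "x * ln (a + b) - xlnx x \<le> - (x * ln r) + (r * (a + b) - x)"
    if "x \<ge> 0" "x \<le> a + b" "r > 0" for x r
  proof (cases "x = 0")
    case False
    then have x: "x > 0" "a + b > 0" using that by auto
    have "ln (r * (a + b) / x) \<le> r * (a + b) / x - 1"
      using x that by (intro ln_le_minus_one) auto
    then have "x * ln (r * (a + b) / x) \<le> x * (r * (a + b) / x - 1)"
      using x by (intro mult_left_mono) auto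
    moreover have "x * (r * (a + b) / x - 1) = r * (a + b) - x"
      using x by (simp add: right_diff_distrib)
    moreover have "ln (r * (a + b) / x) = ln r + ln (a + b) - ln x"
      using x that by (simp add: ln_div ln_mult_pos)
    ultimately show ?thesis
      by (simp add: xlnx_def distrib_left right_diff_distrib)
  qed (use assms that in simp)
  have "split_entropy a b = (a * ln (a + b) - xlnx a) + (b * ln (a + b) - xlnx b)"
    by (simp add: split_entropy_def xlnx_def algebra_simps)
  also have "\<dots> \<le> (- (a * ln p) + (p * (a + b) - a)) + (- (b * ln q) + (q * (a + b) - b))"
    using assms by (intro add_mono *) auto
  also have "\<dots> = - (a * ln p) - b * ln q + ((p + q) * (a + b) - (a + b))"
    by (simp add: algebra_simps)
  finally show ?thesis using assms by simp
qed

lemma split_entropy_sum_le: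
  assumes "\<And>x. x \<in> S \<Longrightarrow> u x \<ge> 0" "\<And>x. x \<in> S \<Longrightarrow> v x \<ge> 0"
  shows "(\<Sum>x\<in>S. split_entropy (u x) (v x)) \<le> split_entropy (sum u S) (sum v S)"
proof (cases "finite S")
  case fin: True
  define U V where "U = sum u S" and "V = sum v S"
  have nn: "U \<ge> 0" "V \<ge> 0" using assms by (auto simp: U_def V_def sum_nonneg)
  show ?thesis
  proof (cases "U = 0 \<or> V = 0")
    case True
    then have "(\<forall>x\<in>S. u x = 0) \<or> (\<forall>x\<in>S. v x = 0)"
      using fin assms by (auto simp: U_def V_def sum_nonneg_eq_0_iff)
    then show ?thesis by auto
  next
    case False
    then have pos: "U > 0" "V > 0" using nn by auto
    \<comment> \<open>The same weights serve for every \<open>x\<close>; choosing the proportions of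
      the totals makes the summed bound equal to \<open>split_entropy U V\<close>.\<close>
    have "(\<Sum>x\<in>S. split_entropy (u x) (v x))
        \<le> (\<Sum>x\<in>S. - (u x * ln (U / (U + V))) - v x * ln (V / (U + V)))"
      using pos assms by (intro sum_mono split_entropy_le_cross_entropy) (auto simp: add_divide_distrib[symmetric])
    also have "\<dots> = - (U * ln (U / (U + V))) - V * ln (V / (U + V))"
      by (simp add: sum_subtractf sum_negf sum_distrib_right U_def V_def)
    also have "\<dots> = split_entropy U V"
      using pos by (simp add: ln_div split_entropy_def xlnx_def algebra_simps)
    finally show ?thesis by (simp add: U_def V_def)
  qed
qed simp

subsection \<open>Grids and convolution\<close>

text \<open>Coordinates outside \<open>A\<close> are pinned to 0, so every lower dimension lives
  inside one type and induction on the dimension becomes induction on the finite set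
  \<open>A\<close>.\<close>

definition grid :: "int set \<Rightarrow> 'd set \<Rightarrow> (int ^ 'd) set"
  where "grid K A = {x. \<forall>i. x $ i \<in> (if i \<in> A then K else {0})}"

lemma grid_empty [simp]: "grid K {} = {0}"
  by (auto simp: grid_def vec_eq_iff)

lemma grid_nth_eq_0: "x \<in> grid K A \<Longrightarrow> i \<notin> A \<Longrightarrow> x $ i = 0"
  unfolding grid_def by (metis (mono_tags, lifting) mem_Collect_eq singletonD)

lemma add_axis_in_grid_insert_iff:
  assumes "i \<notin> A" "x $ i = 0"
  shows "x + axis i k \<in> grid K (insert i A) \<longleftrightarrow> k \<in> K \<and> x \<in> grid K A"
  using assms by (auto simp: grid_def axis_def)

text \<open>Peels off one coordinate: the inverse reads coordinate \<open>i\<close> and then resets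
  it to 0.\<close>

lemma bij_betw_grid_insert:
  assumes "i \<notin> A"
  shows "bij_betw (\<lambda>(k, x). x + axis i k) (K \<times> grid K A) (grid K (insert i A))"
proof (rule bij_betw_byWitness[where f' = "\<lambda>x. (x $ i, x - axis i (x $ i))"])
  show "\<forall>p\<in>K \<times> grid K A. (\<lambda>x. (x $ i, x - axis i (x $ i))) ((\<lambda>(k, x). x + axis i k) p) = p"
    using assms by (auto simp: grid_nth_eq_0)
  show "(\<lambda>(k, x). x + axis i k) ` (K \<times> grid K A) \<subseteq> grid K (insert i A)"
    using assms by (auto simp: grid_nth_eq_0 add_axis_in_grid_insert_iff)
  show "(\<lambda>x. (x $ i, x - axis i (x $ i))) ` grid K (insert i A) \<subseteq> K \<times> grid K A"
  proof (intro image_subsetI)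
    fix x assume "x \<in> grid K (insert i A)"
    then have "(x - axis i (x $ i)) + axis i (x $ i) \<in> grid K (insert i A)" by simp
    then show "(x $ i, x - axis i (x $ i)) \<in> K \<times> grid K A"
      using assms by (subst (asm) add_axis_in_grid_insert_iff) auto
  qed
qed auto

lemma sum_grid_insert:
  assumes "i \<notin> A"
  shows "sum h (grid K (insert i A)) = (\<Sum>k\<in>K. \<Sum>x\<in>grid K A. h (x + axis i k))"
  using sum.reindex_bij_betw[OF bij_betw_grid_insert[OF assms, of K], of h]
  by (simp add: sum.cartesian_product case_prod_unfold)

lemma finite_grid [simp]:
  fixes A :: "'d::finite set"
  assumes "finite K"
  shows "finite (grid K A)"
proof (induction A rule: finite_induct[OF finite])
  case (2 i A)
  then show ?case
    using bij_betw_finite[OF bij_betw_grid_insert[of i A K]] assms by simp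
qed simp

section \<open>Support and total mass of convolutions\<close>

lemma convolution_eq_sum:
  assumes "finite S" "\<And>y. y \<notin> S \<Longrightarrow> g y = 0"
  shows "convolution f g z = (\<Sum>y\<in>S. f (z - y) * g y)"
proof -
  have "(\<Sum>\<^sub>\<infinity>y. f (z - y) * g y) = (\<Sum>\<^sub>\<infinity>y\<in>S. f (z - y) * g y)"
    using assms(2) by (intro infsum_cong_neutral) auto
  then show ?thesis
    using assms(1) by (simp add: convolution_def)
qed

lemma convolution_nonneg:
  assumes "finite S" "\<And>y. y \<notin> S \<Longrightarrow> g y = 0" "\<And>x. f x \<ge> 0" "\<And>x. g x \<ge> 0"
  shows "convolution f g z \<ge> 0"
  by (simp add: convolution_eq_sum[OF assms(1,2)] assms(3,4) sum_nonneg)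

lemma add_in_grid:
  assumes "x \<in> grid {0, 1} A" "y \<in> grid {0, 1} A"
  shows "x + y \<in> grid {0, 1, 2} A"
  unfolding grid_def
proof (intro CollectI allI)
  fix i
  have "x $ i \<in> (if i \<in> A then {0, 1} else {0})" "y $ i \<in> (if i \<in> A then {0, 1} else {0})"
    using assms by (auto simp: grid_def)
  then show "(x + y) $ i \<in> (if i \<in> A then {0, 1, 2} else {0})"
    by (auto split: if_splits)
qed

lemma convolution_eq_0:
  fixes f g :: "int ^ 'd::finite \<Rightarrow> real"
  assumes f: "\<And>x. x \<notin> grid {0, 1} A \<Longrightarrow> f x = 0" and g: "\<And>x. x \<notin> grid {0, 1} A \<Longrightarrow> g x = 0"
    and z: "z \<notin> grid {0, 1, 2} A"
  shows "convolution f g z = 0"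
proof -
  have "f (z - y) = 0" if "y \<in> grid {0, 1} A" for y
    using add_in_grid[of "z - y" A y] that z f by auto
  then show ?thesis
    by (simp add: convolution_eq_sum[of "grid {0, 1} A", OF _ g])
qed

lemma sum_convolution:
  fixes f g :: "int ^ 'd::finite \<Rightarrow> real"
  assumes f: "\<And>x. x \<notin> grid {0, 1} A \<Longrightarrow> f x = 0" and g: "\<And>x. x \<notin> grid {0, 1} A \<Longrightarrow> g x = 0"
  shows "sum (convolution f g) (grid {0, 1, 2} A) = sum f (grid {0, 1} A) * sum g (grid {0, 1} A)"
proof -
  \<comment> \<open>The translate by \<open>y\<close> of the support of \<open>f\<close> stays in
    the larger grid, so the inner sum over \<open>z\<close> does not depend on
    \<open>y\<close>.\<close>
  have shift: "sum f (grid {0, 1} A) = (\<Sum>z\<in>grid {0, 1, 2} A. f (z - y))" if y: "y \<in> grid {0, 1} A" for y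
  proof -
    have "sum f (grid {0, 1} A) = (\<Sum>z\<in>(\<lambda>x. x + y) ` grid {0, 1} A. f (z - y))"
      by (subst sum.reindex) auto
    also have "\<dots> = (\<Sum>z\<in>grid {0, 1, 2} A. f (z - y))"
    proof (rule sum.mono_neutral_left)
      show "(\<lambda>x. x + y) ` grid {0, 1} A \<subseteq> grid {0, 1, 2} A"
        using add_in_grid y by blast
      show "\<forall>z\<in>grid {0, 1, 2} A - (\<lambda>x. x + y) ` grid {0, 1} A. f (z - y) = 0"
      proof
        fix z assume z: "z \<in> grid {0, 1, 2} A - (\<lambda>x. x + y) ` grid {0, 1} A"
        have "z - y \<notin> grid {0, 1} A"
        proof
          assume "z - y \<in> grid {0, 1} A"
          then have "(z - y) + y \<in> (\<lambda>x. x + y) ` grid {0, 1} A" by blast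
          with z show False by simp
        qed
        then show "f (z - y) = 0" by (rule f)
      qed
    qed simp
    finally show ?thesis .
  qed
  have "sum (convolution f g) (grid {0, 1, 2} A)
      = (\<Sum>y\<in>grid {0, 1} A. \<Sum>z\<in>grid {0, 1, 2} A. f (z - y) * g y)"
    by (subst sum.swap) (simp add: convolution_eq_sum[of "grid {0, 1} A", OF _ g])
  also have "\<dots> = (\<Sum>y\<in>grid {0, 1} A. sum f (grid {0, 1} A) * g y)"
    by (intro sum.cong refl) (simp add: shift sum_distrib_right)
  finally show ?thesis by (simp add: sum_distrib_left)
qed

section \<open>Slices along one coordinate\<close>

text \<open>The cutoff to \<open>S\<close> is what makes a slice supported in the smaller grid;
  otherwise points with nonzero coordinate \<open>i\<close> would also pick up values of
  \<open>f\<close>.\<close>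

definition slice :: "(int ^ 'd) set \<Rightarrow> 'd \<Rightarrow> int \<Rightarrow> (int ^ 'd \<Rightarrow> real) \<Rightarrow> int ^ 'd \<Rightarrow> real"
  where "slice S i k f = (\<lambda>x. if x \<in> S then f (x + axis i k) else 0)"

lemma slice_eq_0: "x \<notin> S \<Longrightarrow> slice S i k f x = 0"
  by (simp add: slice_def)

lemma slice_nonneg: "(\<And>x. f x \<ge> 0) \<Longrightarrow> slice S i k f x \<ge> 0"
  by (simp add: slice_def)

text \<open>If the argument of \<open>g\<close> has coordinate \<open>l\<close>, that of
  \<open>f\<close> has coordinate \<open>m - l\<close>; only pairs of bits adding up to
  \<open>m\<close> survive.\<close>

lemma convolution_slice:
  fixes f g :: "int ^ 'd::finite \<Rightarrow> real"
  assumes i: "i \<notin> A" and z: "z $ i = 0"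
    and f: "\<And>x. x \<notin> grid {0, 1} (insert i A) \<Longrightarrow> f x = 0"
    and g: "\<And>x. x \<notin> grid {0, 1} (insert i A) \<Longrightarrow> g x = 0"
  defines "Q \<equiv> grid {0, 1} A"
  shows "convolution f g (z + axis i m) =
    (\<Sum>l\<in>{0, 1}. if m - l \<in> {0, 1} then convolution (slice Q i (m - l) f) (slice Q i l g) z else 0)"
proof -
  have *: "f (z + axis i m - (y + axis i l)) = (if m - l \<in> {0, 1} then slice Q i (m - l) f (z - y) else 0)"
    if "y \<in> Q" for y l
  proof -
    have yi: "(z - y) $ i = 0"
      using that i z by (simp add: Q_def grid_nth_eq_0)
    have "axis i m - axis i l = (axis i (m - l) :: int ^ 'd)"
      by (simp add: axis_def vec_eq_iff)
    then have eq: "z + axis i m - (y + axis i l) = (z - y) + axis i (m - l)"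
      by (simp add: algebra_simps)
    have "f ((z - y) + axis i (m - l)) = 0" if "\<not> (m - l \<in> {0, 1} \<and> z - y \<in> Q)"
      using that by (intro f) (simp only: add_axis_in_grid_insert_iff[OF i yi] Q_def not_False_eq_True)
    then show ?thesis
      unfolding eq by (auto simp: slice_def)
  qed
  have conv: "convolution h (slice Q i l g) z = (\<Sum>y\<in>Q. h (z - y) * slice Q i l g y)" for h l
    by (rule convolution_eq_sum) (auto simp: Q_def slice_eq_0)
  have "convolution f g (z + axis i m)
      = (\<Sum>l\<in>{0, 1}. \<Sum>y\<in>Q. f (z + axis i m - (y + axis i l)) * g (y + axis i l))"
    unfolding Q_def by (subst convolution_eq_sum[of "grid {0, 1} (insert i A)"])
      (use g in \<open>simp_all only: sum_grid_insert[OF i] finite_grid finite.intros\<close>)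
  also have "\<dots> = (\<Sum>l\<in>{0, 1}. if m - l \<in> {0, 1} then
      (\<Sum>y\<in>Q. slice Q i (m - l) f (z - y) * slice Q i l g y) else 0)"
    by (intro sum.cong refl) (simp add: * slice_def)
  also have "\<dots> = (\<Sum>l\<in>{0, 1}. if m - l \<in> {0, 1} then
      convolution (slice Q i (m - l) f) (slice Q i l g) z else 0)"
    by (simp only: conv)
  finally show ?thesis .
qed

text \<open>The layers \<open>m = 0, 1, 2\<close>. The form \<open>z + axis i 0\<close> is kept to
  match the sums over layers produced by \<open>sum_grid_insert\<close>.\<close>

lemma convolution_slice_values:
  fixes f g :: "int ^ 'd::finite \<Rightarrow> real"
  assumes "i \<notin> A" and "z $ i = 0"
    and "\<And>x. x \<notin> grid {0, 1} (insert i A) \<Longrightarrow> f x = 0"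
    and "\<And>x. x \<notin> grid {0, 1} (insert i A) \<Longrightarrow> g x = 0"
  defines "f' \<equiv> \<lambda>k. slice (grid {0, 1} A) i k f" and "g' \<equiv> \<lambda>k. slice (grid {0, 1} A) i k g"
  shows "convolution f g (z + axis i 0) = convolution (f' 0) (g' 0) z"
    and "convolution f g (z + axis i 1) = convolution (f' 0) (g' 1) z + convolution (f' 1) (g' 0) z"
    and "convolution f g (z + axis i 2) = convolution (f' 1) (g' 1) z"
  unfolding f'_def g'_def by (simp_all add: convolution_slice[OF assms(1-4)])

section \<open>Homogeneous entropy and the induction on the dimension\<close>

text \<open>The entropy, in nats, of a measure with arbitrary finite mass, scaled to be homogeneous of
  degree one; this avoids conditional distributions in the chain rule.\<close>

definition mass_entropy :: "'a set \<Rightarrow> ('a \<Rightarrow> real) \<Rightarrow> real"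
  where "mass_entropy S h = xlnx (sum h S) - (\<Sum>x\<in>S. xlnx (h x))"

text \<open>The difference of the two sides is \<open>split_entropy\<close> of the totals minus the
  sum of the pointwise \<open>split_entropy\<close>.\<close>

lemma mass_entropy_add_ge:
  assumes "\<And>x. x \<in> S \<Longrightarrow> u x \<ge> 0" "\<And>x. x \<in> S \<Longrightarrow> v x \<ge> 0"
  shows "mass_entropy S u + mass_entropy S v \<le> mass_entropy S (\<lambda>x. u x + v x)"
  using split_entropy_sum_le[of S u v] assms
  by (simp add: mass_entropy_def split_entropy_def sum.distrib sum_subtractf)

text \<open>The chain rule for coordinate \<open>i\<close>; the \<open>split_entropy\<close> term is
  the entropy of its marginal.\<close>

lemma mass_entropy_slices:
  fixes f :: "int ^ 'd::finite \<Rightarrow> real"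
  assumes "i \<notin> A"
  defines "Q \<equiv> grid {0, 1} A"
  shows "sum f (grid {0, 1} (insert i A)) = sum (slice Q i 0 f) Q + sum (slice Q i 1 f) Q"
    and "mass_entropy (grid {0, 1} (insert i A)) f = mass_entropy Q (slice Q i 0 f)
      + mass_entropy Q (slice Q i 1 f) + split_entropy (sum (slice Q i 0 f) Q) (sum (slice Q i 1 f) Q)"
  using assms by (simp_all add: mass_entropy_def sum_grid_insert slice_def split_entropy_def)

text \<open>Keeping the four product masses apart would give the bracket with factor 1; merging
  \<open>a * d\<close> with \<open>b * c\<close> costs \<open>split_entropy (a * d) (b * c)\<close>,
  at most a quarter of it.\<close>

lemma product_split_entropy_ge:
  assumes "a \<ge> 0" "b \<ge> 0" "c \<ge> 0" "d \<ge> 0"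
  shows "xlnx ((a + b) * (c + d)) - xlnx (a * c) - xlnx (a * d + b * c) - xlnx (b * d)
    \<ge> 3 / 4 * ((c + d) * split_entropy a b + (a + b) * split_entropy c d)"
proof -
  have "xlnx ((a + b) * (c + d)) - xlnx (a * c) - xlnx (a * d) - xlnx (b * c) - xlnx (b * d)
    = (c + d) * split_entropy a b + (a + b) * split_entropy c d"
    unfolding split_entropy_def
    using xlnx_mult[of "a + b" "c + d"] xlnx_mult[of a c] xlnx_mult[of a d] xlnx_mult[of b c]
      xlnx_mult[of b d] assms by (simp add: distrib_left distrib_right right_diff_distrib)
  moreover have "xlnx (a * d + b * c) = split_entropy (a * d) (b * c) + xlnx (a * d) + xlnx (b * c)"
    by (simp add: split_entropy_def)
  ultimately show ?thesis
    using split_entropy_cross_le[OF assms] by argo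
qed

text \<open>The masses as weights make both sides homogeneous of degree one in \<open>f\<close> and
  in \<open>g\<close>, so the induction hypothesis applies to slices of any mass.\<close>

lemma mass_entropy_convolution_ge:
  fixes f g :: "int ^ 'd::finite \<Rightarrow> real"
  assumes "\<And>x. f x \<ge> 0" "\<And>x. g x \<ge> 0"
    and "\<And>x. x \<notin> grid {0, 1} A \<Longrightarrow> f x = 0" "\<And>x. x \<notin> grid {0, 1} A \<Longrightarrow> g x = 0"
  shows "mass_entropy (grid {0, 1, 2} A) (convolution f g)
    \<ge> 3 / 4 * (sum g (grid {0, 1} A) * mass_entropy (grid {0, 1} A) f
      + sum f (grid {0, 1} A) * mass_entropy (grid {0, 1} A) g)"
  using finite[of A] assms
proof (induction A arbitrary: f g rule: finite_induct)
  case empty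
  then show ?case by (simp add: mass_entropy_def)
next
  case (insert i A)
  define Q T where "Q = grid {0, 1} A" and "T = (grid {0, 1, 2} A :: (int ^ 'd) set)"
  define f' g' where "f' = (\<lambda>k. slice Q i k f)" and "g' = (\<lambda>k. slice Q i k g)"
  define w where "w k l = convolution (f' k) (g' l)" for k l
  define F G where "F k = sum (f' k) Q" and "G k = sum (g' k) Q" for k
  have nonneg: "f' k x \<ge> 0" "g' k x \<ge> 0" for k x
    using insert.prems(1,2) by (auto simp: f'_def g'_def slice_nonneg)
  have FG: "F k \<ge> 0" "G k \<ge> 0" for k
    by (auto simp: F_def G_def nonneg sum_nonneg)
  have off: "f' k x = 0" "g' k x = 0" if "x \<notin> Q" for k x
    using that by (auto simp: f'_def g'_def slice_eq_0)
  have wpos: "w k l z \<ge> 0" for k l z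
    unfolding w_def using nonneg off by (intro convolution_nonneg[of Q]) (auto simp: Q_def)
  have mass: "sum (w k l) T = F k * G l" for k l
    unfolding w_def T_def F_def G_def Q_def by (intro sum_convolution) (auto simp: off Q_def)
  have IH: "mass_entropy T (w k l) \<ge> 3 / 4 * (G l * mass_entropy Q (f' k) + F k * mass_entropy Q (g' l))" for k l
    unfolding w_def T_def F_def G_def Q_def
    by (intro insert.IH nonneg off) (auto simp: Q_def)
  have w: "convolution f g (z + axis i 0) = w 0 0 z"
    "convolution f g (z + axis i 1) = w 0 1 z + w 1 0 z"
    "convolution f g (z + axis i 2) = w 1 1 z" if "z \<in> T" for z
    using convolution_slice_values[OF insert.hyps(2) _ insert.prems(3,4), of z] that insert.hyps(2)
    by (simp_all add: w_def f'_def g'_def Q_def T_def grid_nth_eq_0)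
  have sumT: "sum h (grid {0, 1, 2} (insert i A))
      = (\<Sum>z\<in>T. h (z + axis i 0)) + (\<Sum>z\<in>T. h (z + axis i 1)) + (\<Sum>z\<in>T. h (z + axis i 2))"
    for h :: "int ^ 'd \<Rightarrow> real"
    using insert.hyps(2) by (simp add: sum_grid_insert T_def)
  note slices = mass_entropy_slices[OF insert.hyps(2), folded Q_def]
  have fg: "sum f (grid {0, 1} (insert i A)) = F 0 + F 1" "sum g (grid {0, 1} (insert i A)) = G 0 + G 1"
    "mass_entropy (grid {0, 1} (insert i A)) f
      = mass_entropy Q (f' 0) + mass_entropy Q (f' 1) + split_entropy (F 0) (F 1)"
    "mass_entropy (grid {0, 1} (insert i A)) g
      = mass_entropy Q (g' 0) + mass_entropy Q (g' 1) + split_entropy (G 0) (G 1)"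
    unfolding F_def G_def f'_def g'_def by (fact slices)+
  have total: "sum (convolution f g) (grid {0, 1, 2} (insert i A)) = (F 0 + F 1) * (G 0 + G 1)"
    by (subst sum_convolution[where A = "insert i A"]) (use insert.prems in \<open>auto simp: fg\<close>)
  define M where "M = mass_entropy T (\<lambda>z. w 0 1 z + w 1 0 z)"
  \<comment> \<open>Both mixed convolutions land in the middle layer, where superadditivity
    separates them.\<close>
  have M: "M \<ge> mass_entropy T (w 0 1) + mass_entropy T (w 1 0)"
    unfolding M_def by (intro mass_entropy_add_ge wpos)
  have "mass_entropy (grid {0, 1, 2} (insert i A)) (convolution f g)
    = xlnx ((F 0 + F 1) * (G 0 + G 1))
      - ((\<Sum>z\<in>T. xlnx (w 0 0 z)) + (\<Sum>z\<in>T. xlnx (w 0 1 z + w 1 0 z)) + (\<Sum>z\<in>T. xlnx (w 1 1 z)))"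
    unfolding mass_entropy_def total unfolding sumT by (simp only: w cong: sum.cong)
  also have "\<dots> = mass_entropy T (w 0 0) + M + mass_entropy T (w 1 1)
      + (xlnx ((F 0 + F 1) * (G 0 + G 1)) - xlnx (F 0 * G 0) - xlnx (F 0 * G 1 + F 1 * G 0) - xlnx (F 1 * G 1))"
    by (simp add: M_def mass_entropy_def mass sum.distrib)
  finally have eq: "mass_entropy (grid {0, 1, 2} (insert i A)) (convolution f g) = \<dots>" .
  \<comment> \<open>Summed over \<open>k\<close> and \<open>l\<close>, the four induction hypotheses
    give the slice entropies with weights \<open>G 0 + G 1\<close> and \<open>F 0 + F 1\<close>;
    \<open>product_split_entropy_ge\<close> supplies the marginal terms.\<close>
  show ?case
    unfolding eq fg
    using M IH[of 0 0] IH[of 0 1] IH[of 1 0] IH[of 1 1]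
      product_split_entropy_ge[OF FG(1)[of 0] FG(1)[of 1] FG(2)[of 0] FG(2)[of 1]]
    by (simp add: algebra_simps)
qed

subsection \<open>The uniform distribution and Shannon entropy\<close>

lemma binary_cube_eq_grid: "binary_cube = grid {0, 1} UNIV"
  by (simp add: binary_cube_def grid_def)

lemma card_grid:
  fixes A :: "'d::finite set"
  assumes "finite K"
  shows "card (grid K A) = card K ^ card A"
proof (induction A rule: finite_induct[OF finite])
  case (2 i A)
  then show ?case
    using bij_betw_same_card[OF bij_betw_grid_insert[of i A K]] by (simp add: card_cartesian_product)
qed simp

lemma slice_indicator:
  assumes "i \<notin> A" "k \<in> K"
  shows "slice (grid K A) i k (indicator (grid K (insert i A))) = indicator (grid K A)"
  using assms
  by (auto simp: fun_eq_iff slice_def indicator_def grid_nth_eq_0 add_axis_in_grid_insert_iff)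

text \<open>\<open>r A z\<close> counts the representations of \<open>z\<close> as a sum of two cube
  points. A new coordinate yields layers with factors 1, 2, 1, so the sum \<open>s n\<close> in
  dimension \<open>n\<close> satisfies
  \<open>s (n + 1) = 4 * s n + 2 * ln 2 * 4 ^ n\<close>.\<close>

lemma sum_xlnx_convolution_indicator:
  fixes A :: "'d::finite set"
  defines "r \<equiv> \<lambda>A. convolution (indicator (grid {0, 1} A)) (indicator (grid {0, 1} A) :: int ^ 'd \<Rightarrow> real)"
  shows "(\<Sum>z\<in>grid {0, 1, 2} A. xlnx (r A z)) = card A * 4 ^ card A / 2 * ln 2"
proof (induction A rule: finite_induct[OF finite])
  case 1
  have "r {} 0 = 1"
    unfolding r_def by (subst convolution_eq_sum[of "{0}"]) auto
  then show ?case by simp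
next
  case (2 i A)
  define T where "T = (grid {0, 1, 2} A :: (int ^ 'd) set)"
  have nonneg: "r A z \<ge> 0" for z
    unfolding r_def by (intro convolution_nonneg[of "grid {0, 1} A"]) auto
  have mass: "sum (r A) T = 4 ^ card A"
  proof -
    have "sum (r A) T = real (card (grid {0, 1} A :: (int ^ 'd) set)) * card (grid {0, 1} A :: (int ^ 'd) set)"
      unfolding r_def T_def by (subst sum_convolution[where A = A]) auto
    also have "\<dots> = (2 * 2) ^ card A"
      by (simp only: card_grid finite.intros power_mult_distrib) simp
    finally show ?thesis by simp
  qed
  have r: "r (insert i A) (z + axis i 0) = r A z" "r (insert i A) (z + axis i 1) = 2 * r A z"
    "r (insert i A) (z + axis i 2) = r A z" if "z \<in> T" for z
    using that 2 unfolding r_def T_def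
    by (subst convolution_slice_values[of i A z]; simp add: grid_nth_eq_0 slice_indicator)+
  have "(\<Sum>z\<in>grid {0, 1, 2} (insert i A). xlnx (r (insert i A) z))
      = (\<Sum>z\<in>T. xlnx (r (insert i A) (z + axis i 0))) + (\<Sum>z\<in>T. xlnx (r (insert i A) (z + axis i 1)))
        + (\<Sum>z\<in>T. xlnx (r (insert i A) (z + axis i 2)))"
    using 2 by (simp add: sum_grid_insert T_def)
  also have "\<dots> = (\<Sum>z\<in>T. xlnx (r A z)) + (\<Sum>z\<in>T. xlnx (2 * r A z)) + (\<Sum>z\<in>T. xlnx (r A z))"
    by (simp only: r cong: sum.cong)
  also have "(\<Sum>z\<in>T. xlnx (2 * r A z)) = 2 * ln 2 * sum (r A) T + 2 * (\<Sum>z\<in>T. xlnx (r A z))"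
    by (simp add: xlnx_mult nonneg sum.distrib sum_distrib_left) (simp add: xlnx_def mult_ac)
  finally show ?case
    using 2 unfolding mass by (simp add: T_def field_simps)
qed

section \<open>Return to Shannon entropy in bits\<close>

lemma shannon_entropy_eq_sum:
  assumes "finite S" "\<And>x. x \<notin> S \<Longrightarrow> h x = 0"
  shows "shannon_entropy h = - (\<Sum>x\<in>S. xlnx (h x)) / ln 2"
proof -
  have "(\<Sum>\<^sub>\<infinity>x. h x * log 2 (h x)) = (\<Sum>\<^sub>\<infinity>x\<in>S. xlnx (h x) / ln 2)"
    using assms(2) by (intro infsum_cong_neutral) (auto simp: xlnx_def log_def)
  then show ?thesis
    using assms(1) by (simp add: shannon_entropy_def sum_divide_distrib)
qed

text \<open>For total mass 1 the leading term is \<open>xlnx 1 = 0\<close>; division by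
  \<open>ln 2\<close> converts nats to bits.\<close>

lemma shannon_entropy_eq_mass_entropy:
  assumes "finite S" "\<And>x. x \<notin> S \<Longrightarrow> h x = 0" "sum h S = 1"
  shows "shannon_entropy h = mass_entropy S h / ln 2"
  using assms by (simp add: shannon_entropy_eq_sum[of S] mass_entropy_def)

lemma cube_density_iff:
  fixes f :: "int ^ 'd::finite \<Rightarrow> real"
  shows "cube_density f \<longleftrightarrow>
    (\<forall>x. 0 \<le> f x) \<and> (\<forall>x. x \<notin> grid {0, 1} UNIV \<longrightarrow> f x = 0) \<and> sum f (grid {0, 1} UNIV) = 1"
  by (auto simp: cube_density_def binary_cube_eq_grid l1_norm_on_def)

lemma shannon_entropy_convolution_ge:
  fixes f g :: "int ^ 'd::finite \<Rightarrow> real"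
  assumes "cube_density f" "cube_density g"
  shows "shannon_entropy (convolution f g) \<ge> 3 / 4 * (shannon_entropy f + shannon_entropy g)"
proof -
  define Q T where "Q = (grid {0, 1} UNIV :: (int ^ 'd) set)" and "T = (grid {0, 1, 2} UNIV :: (int ^ 'd) set)"
  have fin: "finite Q" "finite T" by (simp_all add: Q_def T_def)
  have f: "\<And>x. f x \<ge> 0" "\<And>x. x \<notin> Q \<Longrightarrow> f x = 0" "sum f Q = 1"
    and g: "\<And>x. g x \<ge> 0" "\<And>x. x \<notin> Q \<Longrightarrow> g x = 0" "sum g Q = 1"
    using assms by (auto simp: cube_density_iff Q_def)
  have sum1: "sum (convolution f g) T = 1"
    using sum_convolution[of UNIV f g] f g by (simp add: Q_def T_def)
  have "convolution f g z = 0" if "z \<notin> T" for z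
    using convolution_eq_0[of UNIV f g z] f(2) g(2) that by (simp add: Q_def T_def)
  note entropy = shannon_entropy_eq_mass_entropy[OF fin(2) this sum1]
    shannon_entropy_eq_mass_entropy[OF fin(1) f(2,3)] shannon_entropy_eq_mass_entropy[OF fin(1) g(2,3)]
  have "3 / 4 * (mass_entropy Q f + mass_entropy Q g) \<le> mass_entropy T (convolution f g)"
    using mass_entropy_convolution_ge[of f g UNIV] f g by (simp add: Q_def T_def)
  from divide_right_mono[OF this, of "ln 2"] show ?thesis
    by (simp add: entropy add_divide_distrib)
qed

lemma cube_density_uniform: "cube_density (uniform_cube :: int ^ 'd::finite \<Rightarrow> real)"
  by (simp add: cube_density_iff uniform_cube_def binary_cube_eq_grid card_grid sum_divide_distrib[symmetric])

lemma shannon_entropy_uniform: "shannon_entropy (uniform_cube :: int ^ 'd::finite \<Rightarrow> real) = CARD('d)"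
proof -
  have "shannon_entropy (uniform_cube :: int ^ 'd \<Rightarrow> real)
      = - (\<Sum>x\<in>(grid {0, 1} UNIV :: (int ^ 'd) set). xlnx (uniform_cube x)) / ln 2"
    by (intro shannon_entropy_eq_sum) (auto simp: uniform_cube_def binary_cube_eq_grid)
  also have "(\<Sum>x\<in>(grid {0, 1} UNIV :: (int ^ 'd) set). xlnx (uniform_cube x))
      = (\<Sum>x\<in>(grid {0, 1} UNIV :: (int ^ 'd) set). xlnx (1 / 2 ^ CARD('d)))"
    by (intro sum.cong) (auto simp: uniform_cube_def binary_cube_eq_grid)
  also have "\<dots> = - CARD('d) * ln 2"
    by (simp add: card_grid xlnx_def ln_div ln_realpow)
  finally show ?thesis by simp
qed

text \<open>Each coordinate of the sum of two independent uniform bits has law (1/4, 1/2, 1/4), of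
  entropy 3/2 bits.\<close>

lemma shannon_entropy_convolution_uniform:
  "shannon_entropy (convolution uniform_cube (uniform_cube :: int ^ 'd::finite \<Rightarrow> real)) = 3 / 2 * CARD('d)"
proof -
  define Q T where "Q = (grid {0, 1} UNIV :: (int ^ 'd) set)" and "T = (grid {0, 1, 2} UNIV :: (int ^ 'd) set)"
  define n where "n = CARD('d)"
  define u :: "int ^ 'd \<Rightarrow> real" where "u = uniform_cube"
  define r :: "int ^ 'd \<Rightarrow> real" where "r = convolution (indicator Q) (indicator Q)"
  have fin: "finite Q" "finite T" by (simp_all add: Q_def T_def)
  have u: "u x = 1 / 2 ^ n * indicator Q x" for x
    by (simp add: u_def uniform_cube_def n_def Q_def binary_cube_eq_grid)
  have four: "(4::real) ^ n = 2 ^ n * 2 ^ n"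
    by (simp add: power_mult_distrib[symmetric])
  have conv: "convolution u u z = 1 / 4 ^ n * r z" for z
  proof -
    have "convolution u u z = (\<Sum>y\<in>Q. u (z - y) * u y)"
      using fin by (intro convolution_eq_sum) (auto simp: u)
    also have "\<dots> = 1 / 4 ^ n * (\<Sum>y\<in>Q. indicator Q (z - y) * indicator Q y)"
      by (simp add: u four sum_distrib_left)
    also have "(\<Sum>y\<in>Q. indicator Q (z - y) * indicator Q y) = r z"
      unfolding r_def using fin by (intro convolution_eq_sum[symmetric]) auto
    finally show ?thesis .
  qed
  have r_nonneg: "r z \<ge> 0" for z
    unfolding r_def using fin by (intro convolution_nonneg[of Q]) auto
  have "sum r T = sum (indicator Q) Q * sum (indicator Q) Q"
    unfolding r_def T_def Q_def by (rule sum_convolution) auto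
  also have "\<dots> = 4 ^ n"
    by (simp add: Q_def card_grid n_def flip: power_mult_distrib)
  finally have mass: "sum r T = 4 ^ n" .
  have "xlnx (convolution u u z) = 1 / 4 ^ n * xlnx (r z) - (2 * n * ln 2 / 4 ^ n) * r z" for z
  proof -
    have "ln (4::real) = 2 * ln 2" using ln_realpow[of 2 2] by simp
    then have "xlnx (1 / 4 ^ n) = - (2 * n * ln 2 / 4 ^ n)"
      by (simp add: xlnx_def ln_div ln_realpow)
    then show ?thesis
      unfolding conv using r_nonneg by (subst xlnx_mult) auto
  qed
  then have "(\<Sum>z\<in>T. xlnx (convolution u u z))
      = 1 / 4 ^ n * (\<Sum>z\<in>T. xlnx (r z)) - (2 * n * ln 2 / 4 ^ n) * sum r T"
    by (simp add: sum_subtractf sum_distrib_left)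
  also have "(\<Sum>z\<in>T. xlnx (r z)) = n * 4 ^ n / 2 * ln 2"
    unfolding r_def Q_def T_def n_def by (rule sum_xlnx_convolution_indicator)
  \<comment> \<open>The normalisation contributes \<open>- 2 * n * ln 2\<close> and the
    representation counts give back \<open>n / 2 * ln 2\<close>.\<close>
  finally have "(\<Sum>z\<in>T. xlnx (convolution u u z)) = - (3 / 2 * n) * ln 2"
    unfolding mass by simp
  moreover have "convolution u u z = 0" if "z \<notin> T" for z
    using that by (intro convolution_eq_0[of UNIV]) (auto simp: u Q_def T_def)
  ultimately have "shannon_entropy (convolution u u) = 3 / 2 * n"
    by (subst shannon_entropy_eq_sum[OF fin(2)]) auto
  then show ?thesis by (simp add: u_def n_def)
qed

theorem corollary9:
  shows "(\<forall>f g :: int ^ 'd \<Rightarrow> real. cube_density f \<and> cube_density g \<longrightarrow>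
            shannon_entropy (convolution f g) \<ge> 3 / 4 * (shannon_entropy f + shannon_entropy g))
       \<and> cube_density (uniform_cube :: int ^ 'd \<Rightarrow> real)
       \<and> shannon_entropy (convolution uniform_cube (uniform_cube :: int ^ 'd \<Rightarrow> real)) =
            3 / 4 * (shannon_entropy (uniform_cube :: int ^ 'd \<Rightarrow> real)
                     + shannon_entropy (uniform_cube :: int ^ 'd \<Rightarrow> real))
       \<and> (\<forall>c::real. (\<forall>f g :: int ^ 'd \<Rightarrow> real. cube_density f \<and> cube_density g \<longrightarrow>
              shannon_entropy (convolution f g) \<ge> c * (shannon_entropy f + shannon_entropy g))
            \<longrightarrow> c \<le> 3 / 4)"
proof (intro conjI allI impI)
  show "shannon_entropy (convolution f g) \<ge> 3 / 4 * (shannon_entropy f + shannon_entropy g)"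
    if "cube_density f \<and> cube_density g" for f g :: "int ^ 'd \<Rightarrow> real"
    using that shannon_entropy_convolution_ge by blast
  show "cube_density (uniform_cube :: int ^ 'd \<Rightarrow> real)"
    by (rule cube_density_uniform)
  show "shannon_entropy (convolution uniform_cube (uniform_cube :: int ^ 'd \<Rightarrow> real)) =
      3 / 4 * (shannon_entropy (uniform_cube :: int ^ 'd \<Rightarrow> real)
        + shannon_entropy (uniform_cube :: int ^ 'd \<Rightarrow> real))"
    by (simp add: shannon_entropy_convolution_uniform shannon_entropy_uniform)
  fix c :: real
  assume "\<forall>f g :: int ^ 'd \<Rightarrow> real. cube_density f \<and> cube_density g \<longrightarrow>
      shannon_entropy (convolution f g) \<ge> c * (shannon_entropy f + shannon_entropy g)"
  then have "c * (shannon_entropy (uniform_cube :: int ^ 'd \<Rightarrow> real)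
        + shannon_entropy (uniform_cube :: int ^ 'd \<Rightarrow> real))
      \<le> shannon_entropy (convolution uniform_cube (uniform_cube :: int ^ 'd \<Rightarrow> real))"
    using cube_density_uniform by blast
  \<comment> \<open>In dimension \<open>d\<close> the assumption at the uniform density reads
    \<open>c * (2 * d) \<le> 3 / 2 * d\<close>, and \<open>d\<close> is positive.\<close>
  then show "c \<le> 3 / 4"
    by (simp add: shannon_entropy_convolution_uniform shannon_entropy_uniform)
qed

end
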